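(* Let $\mathcal{A}$ be a C*-algebra and let $x \in \mathcal{A}$ with $\|x\| = 1$. Then $x$ is a partial isometry if and only if $$\{y \in \mathcal{A} : \text{there exists } a > 0 \text{ with } \|x + ay\| = \|x - ay\| = 1\} = \{y \in \mathcal{A} : \|x + by\| = \max(1, \|by\|) \text{ for all } b \in \mathbb{C}\}.$$
   Context: C*-algebras are complex and are not assumed to be unital. An element $x$ of a C*-algebra is a partial isometry if $x^*x$ is a projection (equivalently $xx^*x = x$). *)

theory Defs
  imports "HOL-Analysis.Analysis"
begin

text \<open>
  Additive structure, norm, completeness and submultiplicativity are inherited from
  \<^class>\<open>real_normed_algebra\<close> and \<^class>\<open>banach\<close>, neither of which requires a unit.
\<close>

class complex_banach_algebra = real_normed_algebra + banach +
  fixes scaleC :: "complex \<Rightarrow> 'a \<Rightarrow> 'a"  (infixr "*\<^sub>C" 75)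
  assumes scaleR_scaleC: "r *\<^sub>R x = complex_of_real r *\<^sub>C x"
    and scaleC_add_right: "c *\<^sub>C (x + y) = c *\<^sub>C x + c *\<^sub>C y"
    and scaleC_add_left: "(c + d) *\<^sub>C x = c *\<^sub>C x + d *\<^sub>C x"
    and scaleC_scaleC: "c *\<^sub>C (d *\<^sub>C x) = (c * d) *\<^sub>C x"
    and scaleC_one: "1 *\<^sub>C x = x"
    and mult_scaleC_left: "(c *\<^sub>C x) * y = c *\<^sub>C (x * y)"
    and mult_scaleC_right: "x * (c *\<^sub>C y) = c *\<^sub>C (x * y)"
    and norm_scaleC: "norm (c *\<^sub>C x) = cmod c * norm x"

class cstar_algebra = complex_banach_algebra +
  fixes star :: "'a \<Rightarrow> 'a"
  assumes star_star: "star (star x) = x"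
    and star_add: "star (x + y) = star x + star y"
    and star_scaleC: "star (c *\<^sub>C x) = cnj c *\<^sub>C star x"
    and star_mult: "star (x * y) = star y * star x"
    and cstar_identity: "norm (star x * x) = (norm x)\<^sup>2"

definition projection :: "'a::cstar_algebra \<Rightarrow> bool" where
  "projection p \<longleftrightarrow> star p = p \<and> p * p = p"

definition partial_isometry :: "'a::cstar_algebra \<Rightarrow> bool" where
  "partial_isometry x \<longleftrightarrow> projection (star x * x)"

end

theory Submission
  imports Defs "HOL-Real_Asymp.Real_Asymp"
begin

text \<open>
  Let \<open>p = star x * x\<close>. If \<open>x\<close> is a partial isometry and \<open>norm (x + z)\<close>, \<open>norm (x - z)\<close> are at
  most \<open>1\<close>, then averaging \<open>star (x \<plusminus> z) * (x \<plusminus> z) \<le> 1\<close> gives \<open>p + star z * z \<le> 1\<close>, and compressing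
  by the projection \<open>p\<close> gives \<open>z * p = 0\<close>; likewise for the adjoints. So \<open>x\<close> and \<open>z\<close> have
  orthogonal supports and ranges, and \<open>norm (x + c z)\<close> is the maximum of the two norms.
  Conversely the defect \<open>y = x - x * star x * x\<close> corresponds to the function \<open>t - t ^ 3\<close>
  on \<open>[0, 1]\<close>: \<open>x \<plusminus> y / 2\<close> stay in the unit ball since \<open>t \<plusminus> (t - t ^ 3) / 2\<close> are at most \<open>1\<close>,
  while if \<open>y \<noteq> 0\<close>, then at the point where \<open>t - t ^ 3\<close> is maximal \<open>x + y / norm y\<close>
  exceeds \<open>1\<close>.

  Instead of the functional calculus, the proof uses the unitization and an order on self-adjoint
  elements defined by norm inequalities, for which \<open>star x * x\<close> is shown to be positive.
\<close>

subsection \<open>Scalar multiplication and adjoint\<close>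

lemma scaleC_zero_right [simp]: "c *\<^sub>C (0::'a::complex_banach_algebra) = 0"
  using scaleC_add_right[of c 0 "0::'a"] by simp

lemma scaleC_zero_left [simp]: "0 *\<^sub>C (x::'a::complex_banach_algebra) = 0"
  using scaleR_scaleC[of 0 x] by simp

lemma scaleC_minus_left: "(- c) *\<^sub>C (x::'a::complex_banach_algebra) = - (c *\<^sub>C x)"
  using scaleC_add_left[of "- c" c x] by (simp add: eq_neg_iff_add_eq_0)

lemma scaleC_minus_right: "c *\<^sub>C (- x::'a::complex_banach_algebra) = - (c *\<^sub>C x)"
  using scaleC_add_right[of c "- x" x] by (simp add: eq_neg_iff_add_eq_0)

lemma scaleC_diff_right: "c *\<^sub>C (x - y::'a::complex_banach_algebra) = c *\<^sub>C x - c *\<^sub>C y"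
  using scaleC_add_right[of c x "- y"] by (simp add: scaleC_minus_right)

lemma star_scaleR [simp]: "star (r *\<^sub>R x) = r *\<^sub>R star (x::'a::cstar_algebra)"
  by (simp add: scaleR_scaleC star_scaleC)

lemma star_zero [simp]: "star (0::'a::cstar_algebra) = 0"
  using star_scaleR[of 0 "0::'a"] by simp

lemma star_minus [simp]: "star (- x) = - star (x::'a::cstar_algebra)"
  using star_scaleR[of "-1" x] by simp

lemma star_diff: "star (x - y) = star x - star (y::'a::cstar_algebra)"
  using star_add[of x "- y"] by simp

lemma norm_star [simp]: "norm (star x) = norm (x::'a::cstar_algebra)"
proof -
  have le: "norm y \<le> norm (star y)" for y :: 'a
  proof (cases "y = 0")
    case False
    have "norm y * norm y \<le> norm (star y) * norm y"
      using norm_mult_ineq[of "star y" y] by (simp add: cstar_identity power2_eq_square)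
    with False show ?thesis by simp
  qed simp
  show ?thesis using le[of x] le[of "star x"] by (simp add: star_star)
qed

lemma bounded_linear_star: "bounded_linear (star :: 'a::cstar_algebra \<Rightarrow> 'a)"
  by (rule bounded_linear_intro[where K = 1]) (simp_all add: star_add)

subsection \<open>Unital algebras\<close>

class unital_cstar_algebra = cstar_algebra + real_normed_algebra_1

lemma star_one [simp]: "star (1::'a::unital_cstar_algebra) = 1"
  by (metis mult.left_neutral mult.right_neutral star_mult star_star)

lemma star_of_real [simp]: "star (of_real r :: 'a::unital_cstar_algebra) = of_real r"
  by (simp add: of_real_def)

lemma star_power: "star (x ^ n) = star (x::'a::unital_cstar_algebra) ^ n"
  by (induction n) (simp_all add: star_mult power_commutes)

text \<open>For a self-adjoint element the C*-identity reads
  \<open>norm (v * v) = norm v * norm v\<close> and can be iterated. Together with the next lemma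
  this replaces the spectral radius formula.\<close>

lemma norm_power_two_power:
  fixes v :: "'a::unital_cstar_algebra"
  assumes "star v = v"
  shows "norm (v ^ 2 ^ n) = norm v ^ 2 ^ n"
proof (induction n)
  case (Suc n)
  have "norm (v ^ 2 ^ Suc n) = norm (star (v ^ 2 ^ n) * v ^ 2 ^ n)"
    using assms by (simp add: star_power power_add mult_2)
  also have "\<dots> = norm v ^ 2 ^ Suc n"
    by (simp add: cstar_identity Suc.IH power_mult[symmetric] mult.commute)
  finally show ?case .
qed simp

text \<open>If \<open>r > t > 0\<close>, then \<open>(r / t) ^ 2 ^ n\<close> would outgrow every
  bound that is linear in \<open>2 ^ n\<close>. Only the exponents \<open>2 ^ n\<close> matter,
  since norms of self-adjoint elements are multiplicative there.\<close>

lemma power_growth_le: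
  fixes r t A B :: real
  assumes "t \<ge> 0" and le: "\<And>n. r ^ 2 ^ n \<le> (A + B * 2 ^ n) * t ^ 2 ^ n"
  shows "r \<le> t"
proof (rule ccontr)
  assume "\<not> r \<le> t"
  then have r: "r > t" by simp
  then have t: "t > 0" using le[of 0] assms(1) by (cases "t = 0") auto
  define q where "q = r / t"
  have q: "q > 1" using r t by (simp add: q_def)
  have "((\<lambda>n. (A + B * real n) / q ^ n) \<longlongrightarrow> 0) sequentially"
    using q by real_asymp
  moreover have "filterlim (\<lambda>n. 2 ^ n :: nat) at_top sequentially"
    by real_asymp
  ultimately have "((\<lambda>n. (A + B * real (2 ^ n)) / q ^ 2 ^ n) \<longlongrightarrow> 0) sequentially"
    by (rule filterlim_compose)
  then have "\<forall>\<^sub>F n in sequentially. (A + B * real (2 ^ n)) / q ^ 2 ^ n < 1"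
    by (rule order_tendstoD) simp
  then obtain n where "(A + B * real (2 ^ n)) / q ^ 2 ^ n < 1"
    by (auto simp: eventually_sequentially)
  then have "A + B * 2 ^ n < q ^ 2 ^ n" using q by (simp add: divide_simps)
  moreover have "q ^ 2 ^ n \<le> A + B * 2 ^ n"
    using le[of n] t by (simp add: q_def power_divide divide_simps)
  ultimately show False by simp
qed

subsection \<open>Square roots\<close>

text \<open>Vandermonde convolution: the binomial series of the square root of \<open>1 + X\<close>
  squares to \<open>1 + X\<close>.\<close>

lemma gbinomial_half_convolution:
  "(\<Sum>i\<le>n. ((1/2::real) gchoose i) * ((1/2) gchoose (n - i))) = (if n \<le> 1 then 1 else 0)"
proof -
  have "(\<Sum>i\<le>n. ((1/2::real) gchoose i) * ((1/2) gchoose (n - i))) = (1 gchoose n)"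
    using gbinomial_Vandermonde[of "1/2::real" "1/2" n] by (simp add: atLeast0AtMost)
  also have "\<dots> = of_nat (1 choose n)"
    by (metis binomial_gbinomial of_nat_1)
  also have "\<dots> = (if n \<le> 1 then 1 else 0)"
    by (cases n) (auto simp: le_Suc_eq)
  finally show ?thesis .
qed

text \<open>Consecutive coefficients have the ratio \<open>(1/2 - n) / (n + 1)\<close>, whose
  absolute value is at most \<open>1\<close>.\<close>

lemma abs_gbinomial_half_le_1: "\<bar>(1/2::real) gchoose n\<bar> \<le> 1"
proof (induction n)
  case (Suc n)
  have "real (Suc n) * ((1/2::real) gchoose Suc n) = (1/2 - real n) * (1/2 gchoose n)"
    using gbinomial_absorb_comp[of "1/2::real" n] gbinomial_absorption[of n "1/2::real"]
    by simp
  then have "((1/2::real) gchoose Suc n) = (1/2 gchoose n) * ((1/2 - real n) / real (Suc n))"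
    by (simp add: field_simps)
  then have "\<bar>(1/2::real) gchoose Suc n\<bar> = \<bar>1/2 gchoose n\<bar> * \<bar>(1/2 - real n) / real (Suc n)\<bar>"
    by (simp add: abs_mult)
  also have "\<dots> \<le> 1 * 1"
    using Suc by (intro mult_mono) (auto simp: divide_simps)
  finally show ?case by simp
qed simp

text \<open>The root is the binomial series in \<open>- h\<close>, squared by the Cauchy product.
  Self-adjointness and commutation hold for each term and pass to the sum.\<close>

lemma sqrt_exists:
  fixes h :: "'a::unital_cstar_algebra"
  assumes sa: "star h = h" and "norm h < 1"
  shows "\<exists>s. star s = s \<and> s * s = 1 - h \<and> (\<forall>k. k * h = h * k \<longrightarrow> k * s = s * k)"
proof -
  define f where "f n = ((1/2::real) gchoose n) *\<^sub>R (- h) ^ n" for n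
  have norm_f: "norm (f n) \<le> norm h ^ n" for n
  proof -
    have "norm (f n) = \<bar>1/2 gchoose n\<bar> * norm ((- h) ^ n)" by (simp add: f_def)
    also have "\<dots> \<le> 1 * norm h ^ n"
      using abs_gbinomial_half_le_1[of n] norm_power_ineq[of "- h" n]
      by (intro mult_mono) auto
    finally show ?thesis by simp
  qed
  have summable_norm: "summable (\<lambda>n. norm (f n))"
    by (rule summable_comparison_test[OF _ summable_geometric[of "norm h"]])
      (use norm_f assms in auto)
  then have summable: "summable f" by (rule summable_norm_cancel)
  define s where "s = suminf f"
  have f_sums: "f sums s" using summable by (simp add: s_def summable_sums)
  have conv: "(\<Sum>i\<le>n. f i * f (n - i)) = (if n \<le> 1 then (- h) ^ n else 0)" for n
  proof -
    have "(\<Sum>i\<le>n. f i * f (n - i)) =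
        (\<Sum>i\<le>n. (((1/2::real) gchoose i) * ((1/2) gchoose (n - i))) *\<^sub>R (- h) ^ n)"
      by (intro sum.cong) (auto simp: f_def power_add[symmetric])
    then show ?thesis
      by (simp add: scaleR_left.sum[symmetric] gbinomial_half_convolution)
  qed
  have "(\<lambda>n. if n \<le> 1 then (- h) ^ n else 0) sums (s * s)"
    using Cauchy_product_sums[OF summable_norm summable_norm] by (simp add: conv s_def)
  moreover have "(\<lambda>n. if n \<le> 1 then (- h) ^ n else 0) sums (\<Sum>n\<le>1. (- h) ^ n)"
    using sums_If_finite_set[of "{..1::nat}" "\<lambda>n. (- h) ^ n"] by simp
  ultimately have "s * s = 1 - h" using sums_unique2 by fastforce
  moreover have "star s = s"
  proof -
    have "(\<lambda>n. star (f n)) sums star s"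
      using bounded_linear.sums[OF bounded_linear_star f_sums] .
    moreover have "(\<lambda>n. star (f n)) = f" by (simp add: f_def star_power sa fun_eq_iff)
    ultimately show ?thesis using f_sums sums_unique2 by metis
  qed
  moreover have "k * s = s * k" if "k * h = h * k" for k
  proof -
    have "(- h) ^ n * k = k * (- h) ^ n" for n
      by (rule power_commuting_commutes) (simp add: that)
    then have "(\<lambda>n. f n * k) = (\<lambda>n. k * f n)" by (simp add: f_def)
    then show ?thesis
      using sums_mult[OF f_sums, of k] sums_mult2[OF f_sums, of k] sums_unique2 by metis
  qed
  ultimately show ?thesis by blast
qed

text \<open>If \<open>r\<close> and \<open>w\<close> are commuting self-adjoint elements, then \<open>u = r + i w\<close> satisfies
  \<open>star u * u = r * r + w * w\<close>, and \<open>w\<close> is the imaginary part of \<open>u\<close>.\<close>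

lemma norm_le_if_sum_squares:
  fixes r w :: "'a::unital_cstar_algebra"
  assumes sa: "star r = r" "star w = w" and comm: "r * w = w * r"
    and eq: "r * r + w * w = of_real (t\<^sup>2)" and "t \<ge> 0"
  shows "norm w \<le> t"
proof -
  define u where "u = r + \<i> *\<^sub>C w"
  have star_u: "star u = r - \<i> *\<^sub>C w"
    by (simp add: u_def star_add star_scaleC sa scaleC_minus_left)
  have "star u * u = r * r + w * w"
    by (subst star_u) (simp add: u_def algebra_simps comm mult_scaleC_left mult_scaleC_right
        scaleC_scaleC scaleC_diff_right scaleC_minus_left scaleC_one)
  then have "(norm u)\<^sup>2 = t\<^sup>2"
    using cstar_identity[of u] eq by (simp del: of_real_power)
  then have "norm u = t" using assms(5) by (simp add: power2_eq_iff_nonneg)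
  then have "norm (u - star u) \<le> t + t"
    using norm_triangle_ineq4[of u "star u"] by simp
  moreover have "u - star u = (2 * \<i>) *\<^sub>C w"
    unfolding star_u by (simp add: u_def scaleC_add_left[symmetric])
  ultimately show ?thesis by (simp add: norm_scaleC norm_mult)
qed

subsection \<open>Positive elements\<close>

text \<open>Positivity is expressed through the norm: for self-adjoint \<open>a\<close>, the bound
  \<open>norm (t - a) \<le> t\<close> confines the spectrum of \<open>a\<close> to \<open>[0, 2 t]\<close>.\<close>

definition cstar_positive :: "'a::unital_cstar_algebra \<Rightarrow> bool" where
  "cstar_positive a \<longleftrightarrow> star a = a \<and> (\<exists>t\<ge>0. norm (of_real t - a) \<le> t)"

lemma positive_star: "cstar_positive a \<Longrightarrow> star a = a"
  by (simp add: cstar_positive_def)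

lemma positive_add:
  assumes "cstar_positive a" "cstar_positive b"
  shows "cstar_positive (a + b)"
proof -
  obtain s t where "s \<ge> 0" "norm (of_real s - a) \<le> s" "t \<ge> 0" "norm (of_real t - b) \<le> t"
    using assms by (auto simp: cstar_positive_def)
  then have "norm (of_real (s + t) - (a + b)) \<le> s + t"
    using norm_triangle_ineq[of "of_real s - a" "of_real t - b"] by (simp add: algebra_simps)
  with \<open>s \<ge> 0\<close> \<open>t \<ge> 0\<close> show ?thesis
    using assms by (auto simp: cstar_positive_def star_add intro!: exI[of _ "s + t"])
qed

lemma positive_scaleR:
  assumes "cstar_positive a" "r \<ge> 0"
  shows "cstar_positive (r *\<^sub>R a)"
proof -
  obtain t where t: "t \<ge> 0" "norm (of_real t - a) \<le> t"
    using assms by (auto simp: cstar_positive_def)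
  have "of_real (r * t) - r *\<^sub>R a = r *\<^sub>R (of_real t - a)"
    by (simp add: scaleR_right_diff_distrib of_real_def)
  then have "norm (of_real (r * t) - r *\<^sub>R a) = r * norm (of_real t - a)"
    using assms(2) by simp
  also have "\<dots> \<le> r * t" using t assms(2) by (simp add: mult_left_mono)
  finally show ?thesis
    using t assms by (auto simp: cstar_positive_def intro!: exI[of _ "r * t"])
qed

lemma positive_scaleR_iff:
  assumes "r > 0"
  shows "cstar_positive (r *\<^sub>R a) \<longleftrightarrow> cstar_positive a"
  using positive_scaleR[of a r] positive_scaleR[of "r *\<^sub>R a" "inverse r"] assms by auto

lemma positive_of_real: "t \<ge> 0 \<Longrightarrow> cstar_positive (of_real t)"
  by (auto simp: cstar_positive_def intro!: exI[of _ t])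

lemma positive_of_real_diff:
  assumes "star w = w" "norm w \<le> t"
  shows "cstar_positive (of_real t - w)"
proof -
  have "0 \<le> t" using assms(2) norm_ge_zero[of w] by linarith
  with assms show ?thesis by (auto simp: cstar_positive_def star_diff intro!: exI[of _ t])
qed

text \<open>After scaling to norm below \<open>1\<close>, let \<open>s\<close> be the root of
  \<open>1 - k' * k'\<close>. It commutes with \<open>k'\<close>, so
  \<open>norm_le_if_sum_squares\<close> gives \<open>norm s \<le> 1\<close>. Hence
  \<open>norm (1 - k' * k') \<le> 1\<close>, which is positivity with the witness
  \<open>1\<close>.\<close>

lemma positive_square:
  assumes sa: "star k = k"
  shows "cstar_positive (k * k)"
proof -
  define r where "r = norm k + 1"
  have r: "r > 0" "norm k < r" by (simp_all add: r_def add_nonneg_pos)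
  define k' where "k' = inverse r *\<^sub>R k"
  have k': "star k' = k'" "norm k' < 1" using sa r by (simp_all add: k'_def field_simps)
  have "norm (k' * k') < 1"
    using k' norm_mult_ineq[of k' k'] mult_strict_mono[of "norm k'" 1 "norm k'" 1] by simp
  then obtain s where s: "star s = s" "s * s = 1 - k' * k'" "k' * s = s * k'"
    using sqrt_exists[of "k' * k'"] k' by (auto simp: star_mult mult.assoc)
  have "norm s \<le> 1"
    using norm_le_if_sum_squares[of k' s 1] s k' by simp
  then have "norm (s * s) \<le> 1"
    using norm_mult_ineq[of s s] mult_mono[of "norm s" 1 "norm s" 1] by simp
  then have "cstar_positive (k' * k')"
    using k' s(2) by (auto simp: cstar_positive_def star_mult intro!: exI[of _ 1])
  moreover have "k' * k' = (inverse r * inverse r) *\<^sub>R (k * k)" by (simp add: k'_def)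
  ultimately show ?thesis using r positive_scaleR_iff[of "inverse r * inverse r"]
    by (metis inverse_positive_iff_positive mult_pos_pos)
qed

text \<open>With \<open>r = t + e\<close>, the element \<open>a + of_real e\<close> is
  \<open>r\<close> times \<open>1 - h\<close> for \<open>h = (t - a) / r\<close>. The shift by
  \<open>e\<close> makes \<open>norm h\<close> strictly less than \<open>1\<close>, as the binomial
  series requires.\<close>

lemma positive_sqrt:
  fixes a :: "'a::unital_cstar_algebra"
  assumes "cstar_positive a" "e > 0"
  shows "\<exists>s. star s = s \<and> s * s = a + of_real e \<and> (\<forall>k. k * a = a * k \<longrightarrow> k * s = s * k)"
proof -
  obtain t where t: "t \<ge> 0" "norm (of_real t - a) \<le> t"
    using assms by (auto simp: cstar_positive_def)
  define r where "r = t + e"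
  have r: "r > 0" using t assms by (simp add: r_def)
  define h where "h = inverse r *\<^sub>R (of_real t - a)"
  have "star h = h" using assms(1) by (simp add: h_def star_diff positive_star)
  moreover have "norm h < 1" using t r assms(2)
    by (simp add: h_def r_def divide_less_eq flip: divide_inverse_commute)
  ultimately obtain s where s: "star s = s" "s * s = 1 - h"
    "\<And>k. k * h = h * k \<Longrightarrow> k * s = s * k"
    using sqrt_exists by blast
  define s' where "s' = sqrt r *\<^sub>R s"
  have "s' * s' = r *\<^sub>R (1 - h)" using r s(2) by (simp add: s'_def)
  also have "\<dots> = of_real r - (of_real t - a)"
    using r by (simp add: h_def scaleR_right_diff_distrib of_real_def)
  also have "\<dots> = a + of_real e" by (simp add: r_def)
  finally have "s' * s' = a + of_real e" .
  moreover have "k * s' = s' * k" if "k * a = a * k" for k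
  proof -
    have "k * h = h * k"
      by (simp add: h_def right_diff_distrib left_diff_distrib of_real_def that)
    then have "k * s = s * k" by (rule s(3))
    then show ?thesis by (simp add: s'_def)
  qed
  moreover have "star s' = s'" using s(1) by (simp add: s'_def)
  ultimately show ?thesis by blast
qed

text \<open>For commuting roots \<open>r\<close> and \<open>s\<close> of \<open>t + e - w\<close>
  and \<open>t + e + w\<close>, the square of \<open>r * s\<close> is
  \<open>(t + e)\<^sup>2 - w * w\<close>, so \<open>norm_le_if_sum_squares\<close> bounds
  \<open>w\<close> by \<open>t + e\<close>.\<close>

lemma norm_le_if_positive:
  fixes w :: "'a::unital_cstar_algebra"
  assumes minus: "cstar_positive (of_real t - w)" and plus: "cstar_positive (of_real t + w)"
    and "t \<ge> 0"
  shows "norm w \<le> t"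
proof (rule field_le_epsilon)
  fix e :: real assume e: "e > 0"
  have sa: "star w = w" using positive_star[OF plus] by (simp add: star_add)
  obtain r where r: "star r = r" "r * r = of_real t - w + of_real e"
    "\<And>k. k * (of_real t - w) = (of_real t - w) * k \<Longrightarrow> k * r = r * k"
    using positive_sqrt[OF minus e] by blast
  have wr: "w * r = r * w" by (rule r(3)) (simp add: algebra_simps of_real_def)
  obtain s where s: "star s = s" "s * s = of_real t + w + of_real e"
    "\<And>k. k * (of_real t + w) = (of_real t + w) * k \<Longrightarrow> k * s = s * k"
    using positive_sqrt[OF plus e] by blast
  have ws: "w * s = s * w" by (rule s(3)) (simp add: algebra_simps of_real_def)
  have rs: "r * s = s * r" by (rule s(3)) (simp add: algebra_simps of_real_def wr)
  have "(r * s) * (r * s) = (r * r) * (s * s)" by (metis mult.assoc rs)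
  also have "\<dots> = of_real ((t + e)\<^sup>2) - w * w"
    unfolding r(2) s(2)
    by (simp add: of_real_def algebra_simps power2_eq_square flip: scaleR_add_left)
  finally have "(r * s) * (r * s) + w * w = of_real ((t + e)\<^sup>2)" by simp
  moreover have "star (r * s) = r * s" using r(1) s(1) rs by (simp add: star_mult)
  moreover have "(r * s) * w = w * (r * s)" by (metis mult.assoc wr ws)
  ultimately show "norm w \<le> t + e"
    using norm_le_if_sum_squares[of "r * s" w "t + e"] sa e assms(3) by simp
qed

text \<open>Since \<open>b\<close> lies below its norm, \<open>a\<close> lies between
  \<open>- norm b\<close> and \<open>norm b\<close> in the order.\<close>

lemma positive_norm_mono:
  assumes "cstar_positive a" "cstar_positive (b - a)"
  shows "norm a \<le> norm b"
proof (rule norm_le_if_positive)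
  have "star b = b" using assms positive_add[of a "b - a"] by (simp add: positive_star)
  then have "cstar_positive ((of_real (norm b) - b) + (b - a))"
    using positive_of_real_diff assms(2) by (intro positive_add) auto
  then show "cstar_positive (of_real (norm b) - a)" by simp
  show "cstar_positive (of_real (norm b) + a)"
    using assms(1) by (intro positive_add positive_of_real) auto
qed simp

text \<open>Stands in for the equality of the nonzero spectra of \<open>star y * y\<close> and \<open>y * star y\<close>.
  The powers of \<open>\<tau> + y * star y\<close> are expressed through those of \<open>\<tau> + star y * y\<close> up to a factor
  of linear growth, which disappears on taking roots.\<close>

lemma norm_add_mult_star_le:
  fixes y :: "'a::unital_cstar_algebra"
  assumes "0 \<le> \<tau>" "\<tau> \<le> t" and le: "norm (of_real \<tau> + star y * y) \<le> t"
  shows "norm (of_real \<tau> + y * star y) \<le> t"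
\<comment> \<open>The growth estimate for the powers divides by \<open>t\<close>. If
  \<open>t = 0\<close>, then \<open>\<tau> = 0\<close> and the assumption forces
  \<open>star y * y = 0\<close>.\<close>
proof (cases "t = 0")
  case True
  then have "y = 0" using assms cstar_identity[of y] by simp
  then show ?thesis using assms by simp
next
  case False
  then have t: "t > 0" using assms by simp
  define a where "a = of_real \<tau> + star y * y"
  define b where "b = of_real \<tau> + y * star y"
  have intertwine: "y * a ^ n = b ^ n * y" for n
  proof (induction n)
    case (Suc n)
    have "y * a = b * y" by (simp add: a_def b_def algebra_simps of_real_def)
    then show ?case using Suc by (metis power_Suc mult.assoc)
  qed simp
  have norm_a: "norm (a ^ n) \<le> t ^ n" for n
    using norm_power_ineq[of a n] power_mono[OF le norm_ge_zero, of n] by (simp add: a_def)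
  have norm_b: "norm (b ^ n) \<le> (1 + (norm y)\<^sup>2 / t * n) * t ^ n" for n
  proof (induction n)
    case (Suc n)
    have "b ^ Suc n = b ^ n * b" by (simp add: power_commutes)
    also have "\<dots> = \<tau> *\<^sub>R b ^ n + b ^ n * (y * star y)"
      by (simp add: b_def algebra_simps of_real_def)
    also have "\<dots> = \<tau> *\<^sub>R b ^ n + y * a ^ n * star y"
      by (simp add: intertwine mult.assoc)
    finally have "norm (b ^ Suc n) \<le> \<tau> * norm (b ^ n) + norm (y * a ^ n * star y)"
      using assms norm_triangle_ineq[of "\<tau> *\<^sub>R b ^ n" "y * a ^ n * star y"] by simp
    also have "norm (y * a ^ n * star y) \<le> norm y * t ^ n * norm y"
    proof -
      have "norm (y * a ^ n * star y) \<le> norm (y * a ^ n) * norm y"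
        using norm_mult_ineq[of "y * a ^ n" "star y"] by simp
      also have "norm (y * a ^ n) \<le> norm y * t ^ n"
        using norm_mult_ineq[of y "a ^ n"] mult_left_mono[OF norm_a norm_ge_zero, of y n]
        by linarith
      finally show ?thesis by (simp add: mult_right_mono)
    qed
    also have "\<tau> * norm (b ^ n) \<le> t * ((1 + (norm y)\<^sup>2 / t * n) * t ^ n)"
      using assms Suc by (intro mult_mono) auto
    finally show ?case using t by (simp add: field_simps power2_eq_square)
  qed simp
  have "star b = b" by (simp add: b_def star_add star_mult star_star)
  then have "norm b ^ 2 ^ n \<le> (1 + (norm y)\<^sup>2 / t * 2 ^ n) * t ^ 2 ^ n" for n
    using norm_b[of "2 ^ n"] by (simp add: norm_power_two_power)
  then have "norm b \<le> t"
    using t power_growth_le[of t "norm b" 1 "(norm y)\<^sup>2 / t"] by simp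
  then show ?thesis by (simp add: b_def)
qed

text \<open>Up to sign, \<open>a\<close> and \<open>b\<close> are twice the real and imaginary parts
  of \<open>y\<close>; in the sum of their squares the terms \<open>y * y\<close> and
  \<open>star y * star y\<close> cancel.\<close>

lemma positive_star_mult_self_add:
  fixes y :: "'a::unital_cstar_algebra"
  shows "cstar_positive (star y * y + y * star y)"
proof -
  define a where "a = y + star y"
  define b where "b = \<i> *\<^sub>C (y - star y)"
  have "star a = a" by (simp add: a_def star_add star_star)
  moreover have "star b = b"
    by (simp add: b_def star_diff star_star star_scaleC scaleC_minus_left scaleC_diff_right)
  ultimately have "cstar_positive (a * a + b * b)"
    by (intro positive_add positive_square)
  moreover have "a * a + b * b = 2 *\<^sub>R (star y * y + y * star y)"
    by (simp add: a_def b_def mult_scaleC_left mult_scaleC_right scaleC_scaleC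
        scaleC_minus_left scaleC_one scaleC_diff_right algebra_simps scaleR_2)
  ultimately show ?thesis
    using positive_scaleR_iff[of 2 "star y * y + y * star y"] by simp
qed

text \<open>The elements \<open>y = x * c ^ n\<close> with \<open>c = 1 - star x * x\<close> single out the possible
  negative part of \<open>h = star x * x\<close>: on the positive part, \<open>star y * y = h * c ^ (2 * n)\<close> stays
  below \<open>1\<close>. As \<open>star y * y + y * star y\<close> is positive, this bounds \<open>star y * y\<close> for all \<open>n\<close>,
  and so the powers of \<open>c\<close> grow at most linearly.\<close>

lemma positive_star_mult_self_aux:
  fixes x :: "'a::unital_cstar_algebra"
  assumes "norm x < 1"
  shows "norm (1 - star x * x) \<le> 1"
proof -
  define h where "h = star x * x"
  define c where "c = 1 - h"
  have sa_h: "star h = h" by (simp add: h_def star_mult star_star)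
  then have sa_c: "star c = c" by (simp add: c_def star_diff)
  have h: "norm h < 1" using assms by (simp add: h_def cstar_identity power_less_one_iff)
  obtain s where s: "star s = s" "s * s = c" "h * s = s * h"
    using sqrt_exists[OF sa_h h] by (auto simp: c_def)
  have hc: "h * c = c * h" by (simp add: c_def algebra_simps)
  \<comment> \<open>Passing from \<open>m\<close> to \<open>m + 1\<close> adds
    \<open>c ^ m * h * h\<close>, which is the square of the self-adjoint element
    \<open>s ^ m * h\<close>.\<close>
  have pos: "cstar_positive (1 - h * c ^ m)" for m
  proof (induction m)
    case 0
    then show ?case using positive_of_real_diff[of h 1] sa_h h by simp
  next
    case (Suc m)
    have hs: "s ^ m * h = h * s ^ m" using power_commuting_commutes[of s h m] s by simp
    have "(s ^ m * h) * (s ^ m * h) = (s ^ m * s ^ m) * (h * h)"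
      by (metis hs mult.assoc)
    also have "s ^ m * s ^ m = c ^ m"
      using s(2) by (metis power_mult_distrib power_commutes power2_eq_square power_mult mult.commute)
    finally have "cstar_positive (c ^ m * (h * h))"
      using positive_square[of "s ^ m * h"] hs s sa_h by (simp add: star_mult star_power)
    moreover have "1 - h * c ^ Suc m = (1 - h * c ^ m) + c ^ m * (h * h)"
    proof -
      have ch: "c ^ m * h = h * c ^ m" using power_commuting_commutes[of c h m] hc by simp
      have "h * c ^ Suc m = h * c ^ m * c" by (simp add: power_commutes mult.assoc)
      also have "\<dots> = h * c ^ m - h * c ^ m * h" unfolding c_def by (simp add: right_diff_distrib)
      also have "h * c ^ m * h = c ^ m * (h * h)" by (metis ch mult.assoc)
      finally show ?thesis by simp
    qed
    ultimately show ?case using Suc positive_add by metis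
  qed
  have even: "norm (h * c ^ (2 * n)) \<le> 1" for n
  proof -
    define y where "y = x * c ^ n"
    have ch: "c ^ n * h = h * c ^ n" using power_commuting_commutes[of c h n] hc by simp
    have "star y * y = c ^ n * h * c ^ n"
      by (simp add: y_def star_mult star_power sa_c h_def mult.assoc)
    also have "\<dots> = h * c ^ (2 * n)" by (simp add: ch mult.assoc power_add[symmetric] mult_2)
    finally have yy: "star y * y = h * c ^ (2 * n)" .
    have pos_y: "cstar_positive (1 - star y * y)" using pos yy by simp
    then obtain t where t: "t \<ge> 0" "norm (of_real t - (1 - star y * y)) \<le> t"
      by (auto simp: cstar_positive_def)
    have "norm (of_real t + star y * y) \<le> t + 1"
    proof -
      have "of_real t + star y * y = (of_real t - (1 - star y * y)) + 1" by simp
      then show ?thesis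
        using t norm_triangle_ineq[of "of_real t - (1 - star y * y)" 1] by simp
    qed
    \<comment> \<open>Exchanging the factors turns the bound for \<open>star y * y\<close> into one
      for \<open>y * star y\<close>, which is positivity of \<open>1 - y * star y\<close> with the
      witness \<open>t + 1\<close>. Adding \<open>star y * y + y * star y\<close> leaves
      \<open>1 + star y * y\<close>.\<close>
    then have "norm (of_real t + y * star y) \<le> t + 1"
      using t by (intro norm_add_mult_star_le) auto
    then have "norm (of_real (t + 1) - (1 - y * star y)) \<le> t + 1" by simp
    then have "cstar_positive (1 - y * star y)"
      using t by (auto simp: cstar_positive_def star_diff star_mult star_star intro!: exI[of _ "t + 1"])
    then have "cstar_positive ((1 - y * star y) + (star y * y + y * star y))"
      using positive_star_mult_self_add by (rule positive_add)
    then have "cstar_positive (1 + star y * y)" by simp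
    then have "norm (star y * y) \<le> 1"
      using pos_y norm_le_if_positive[of 1 "star y * y"] by simp
    then show ?thesis using yy by simp
  qed
  have norm_c: "norm c \<le> 2"
    using norm_triangle_ineq4[of 1 h] h by (simp add: c_def)
  have all: "norm (h * c ^ m) \<le> 2" for m
  proof (cases "even m")
    case True
    then show ?thesis using even[of "m div 2"] by simp
  next
    case False
    then obtain n where m: "m = Suc (2 * n)" by (auto elim: oddE)
    have "norm (h * c ^ m) \<le> norm (h * c ^ (2 * n)) * norm c"
      using norm_mult_ineq[of "h * c ^ (2 * n)" c] by (simp add: m power_commutes mult.assoc)
    also have "\<dots> \<le> 1 * 2" using even[of n] norm_c by (intro mult_mono) auto
    finally show ?thesis by simp
  qed
  \<comment> \<open>Because \<open>c ^ Suc n = c ^ n - h * c ^ n\<close>, each step adds at most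
    \<open>2\<close> to the norm.\<close>
  have "norm (c ^ n) \<le> 1 + 2 * n" for n
  proof (induction n)
    case (Suc n)
    have "c ^ Suc n = c ^ n - h * c ^ n" by (simp add: c_def algebra_simps)
    then show ?case
      using Suc all[of n] norm_triangle_ineq4[of "c ^ n" "h * c ^ n"] by simp
  qed simp
  from this[of "2 ^ _"] have "norm c ^ 2 ^ n \<le> (1 + 2 * 2 ^ n) * 1 ^ 2 ^ n" for n
    by (simp add: norm_power_two_power sa_c)
  then show ?thesis using power_growth_le[of 1 "norm c" 1 2] by (simp add: c_def h_def)
qed

lemma positive_star_mult_self:
  fixes x :: "'a::unital_cstar_algebra"
  shows "cstar_positive (star x * x)"
proof -
  define r where "r = norm x + 1"
  have r: "r > 0" "norm x < r" by (simp_all add: r_def add_nonneg_pos)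
  define x' where "x' = inverse r *\<^sub>R x"
  have "norm x' < 1" using r by (simp add: x'_def field_simps)
  then have "cstar_positive (star x' * x')"
    using positive_star_mult_self_aux
    by (auto simp: cstar_positive_def star_mult star_star intro!: exI[of _ 1])
  moreover have "star x' * x' = (inverse r * inverse r) *\<^sub>R (star x * x)" by (simp add: x'_def)
  ultimately show ?thesis using r positive_scaleR_iff[of "inverse r * inverse r"]
    by (metis inverse_positive_iff_positive mult_pos_pos)
qed

subsection \<open>The unitization\<close>

text \<open>\<open>Unitize c a\<close> stands for the formal sum \<open>c + a\<close>; a new unit is
  adjoined even if the algebra already has one.\<close>

datatype 'a unitization = Unitize (scalar_part: complex) (alg_part: 'a)

lemma unitization_eq_iff: "z = w \<longleftrightarrow> scalar_part z = scalar_part w \<and> alg_part z = alg_part w"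
  by (metis unitization.collapse)

instantiation unitization :: (cstar_algebra) ring_1
begin

definition "0 = Unitize 0 0"
definition "1 = Unitize 1 0"
definition "z + w = Unitize (scalar_part z + scalar_part w) (alg_part z + alg_part w)"
definition "z - w = Unitize (scalar_part z - scalar_part w) (alg_part z - alg_part w)"
definition "- z = Unitize (- scalar_part z) (- alg_part z)"
definition "z * w = Unitize (scalar_part z * scalar_part w)
  (scalar_part z *\<^sub>C alg_part w + scalar_part w *\<^sub>C alg_part z + alg_part z * alg_part w)"

instance
  by standard
    (simp_all add: unitization_eq_iff zero_unitization_def one_unitization_def
      plus_unitization_def minus_unitization_def uminus_unitization_def times_unitization_def
      algebra_simps scaleC_add_left scaleC_add_right scaleC_scaleC scaleC_one
      mult_scaleC_left mult_scaleC_right)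

end

instantiation unitization :: (cstar_algebra) real_algebra_1
begin

definition "r *\<^sub>R z = Unitize (r *\<^sub>R scalar_part z) (r *\<^sub>R alg_part z)"

instance
  by standard
    (simp_all add: unitization_eq_iff plus_unitization_def times_unitization_def
      scaleR_unitization_def algebra_simps scaleC_scaleC scaleR_scaleC scaleR_conv_of_real[where 'a = complex]
      scaleC_one scaleC_add_left scaleC_add_right mult_scaleC_left mult_scaleC_right)

end

lemma unitization_part_simps [simp]:
  "scalar_part (0::'a::cstar_algebra unitization) = 0"
  "alg_part (0::'a unitization) = 0"
  "scalar_part (1::'a unitization) = 1"
  "alg_part (1::'a unitization) = 0"
  "scalar_part (z + w :: 'a unitization) = scalar_part z + scalar_part w"
  "alg_part (z + w :: 'a unitization) = alg_part z + alg_part w"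
  "scalar_part (z - w :: 'a unitization) = scalar_part z - scalar_part w"
  "alg_part (z - w :: 'a unitization) = alg_part z - alg_part w"
  "scalar_part (r *\<^sub>R z :: 'a unitization) = r *\<^sub>R scalar_part z"
  "alg_part (r *\<^sub>R z :: 'a unitization) = r *\<^sub>R alg_part z"
  "scalar_part (z * w :: 'a unitization) = scalar_part z * scalar_part w"
  "alg_part (z * w :: 'a unitization) =
    scalar_part z *\<^sub>C alg_part w + scalar_part w *\<^sub>C alg_part z + alg_part z * alg_part w"
  by (simp_all add: zero_unitization_def one_unitization_def plus_unitization_def
      minus_unitization_def times_unitization_def scaleR_unitization_def)

definition left_action :: "'a::cstar_algebra unitization \<Rightarrow> 'a \<Rightarrow> 'a" where
  "left_action z x = scalar_part z *\<^sub>C x + alg_part z * x"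

lemma bounded_linear_left_action: "bounded_linear (left_action z)"
proof (rule bounded_linear_intro[where K = "cmod (scalar_part z) + norm (alg_part z)"])
  show "norm (left_action z x) \<le> norm x * (cmod (scalar_part z) + norm (alg_part z))" for x
    using norm_triangle_ineq[of "scalar_part z *\<^sub>C x" "alg_part z * x"]
      norm_mult_ineq[of "alg_part z" x]
    by (simp add: left_action_def norm_scaleC algebra_simps)
qed (simp_all add: left_action_def scaleC_add_right algebra_simps scaleR_scaleC
    mult_scaleC_right scaleC_scaleC)

lemma left_action_add: "left_action (z + w) = (\<lambda>x. left_action z x + left_action w x)"
  by (simp add: left_action_def fun_eq_iff scaleC_add_left algebra_simps)

lemma left_action_scaleR: "left_action (r *\<^sub>R z) = (\<lambda>x. r *\<^sub>R left_action z x)"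
  by (simp add: left_action_def fun_eq_iff algebra_simps scaleR_scaleC scaleC_scaleC
      scaleC_add_right scaleR_conv_of_real[where 'a = complex] mult_scaleC_left)

lemma left_action_mult: "left_action (z * w) = left_action z \<circ> left_action w"
  by (simp add: left_action_def fun_eq_iff algebra_simps scaleC_scaleC scaleC_add_right
      mult_scaleC_left mult_scaleC_right)

lemma left_action_one: "left_action 1 = (\<lambda>x. x)"
  by (simp add: left_action_def fun_eq_iff scaleC_one)

text \<open>Left multiplication by \<open>a\<close> is tested on \<open>star a\<close>, where the
  C*-identity gives norm \<open>(norm a)\<^sup>2\<close>. This makes the norm below definite and the
  embedding isometric.\<close>

lemma norm_alg_part_le_onorm:
  assumes "scalar_part z = 0"
  shows "norm (alg_part z) \<le> onorm (left_action z)"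
proof (cases "alg_part z = 0")
  case True
  then show ?thesis by (simp add: onorm_pos_le[OF bounded_linear_left_action])
next
  case False
  let ?a = "alg_part z"
  have "norm ?a * norm ?a = norm (left_action z (star ?a))"
    using cstar_identity[of "star ?a"] assms
    by (simp add: left_action_def star_star power2_eq_square)
  also have "\<dots> \<le> onorm (left_action z) * norm ?a"
    using onorm[OF bounded_linear_left_action, of z "star ?a"] by simp
  finally show ?thesis using False by simp
qed

text \<open>The operator norm of left multiplication alone is only a seminorm if the algebra
  already has a unit; the maximum with the absolute value of the scalar part is a norm in
  either case.\<close>

instantiation unitization :: (cstar_algebra) real_normed_algebra_1
begin

definition "norm z = max (cmod (scalar_part z)) (onorm (left_action z))"
definition "dist z w = norm (z - w)" for z w :: "'a unitization"
definition "sgn z = inverse (norm z) *\<^sub>R z" for z :: "'a unitization"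
definition [code del]:
  "(uniformity :: ('a unitization \<times> 'a unitization) filter) =
    (INF e\<in>{0 <..}. principal {(x, y). dist x y < e})"
definition [code del]:
  "open (U :: 'a unitization set) \<longleftrightarrow>
    (\<forall>x\<in>U. eventually (\<lambda>(x', y). x' = x \<longrightarrow> y \<in> U) uniformity)"

instance
proof
  fix z w :: "'a unitization" and r :: real
  show "dist z w = norm (z - w)" by (rule dist_unitization_def)
  show "sgn z = z /\<^sub>R norm z" by (rule sgn_unitization_def)
  show "(uniformity :: ('a unitization \<times> 'a unitization) filter) =
    (INF e\<in>{0 <..}. principal {(x, y). dist x y < e})"
    by (rule uniformity_unitization_def)
  show "open U \<longleftrightarrow> (\<forall>x\<in>U. eventually (\<lambda>(x', y). x' = x \<longrightarrow> y \<in> U) uniformity)"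
    for U :: "'a unitization set"
    by (rule open_unitization_def)
  show "norm z = 0 \<longleftrightarrow> z = 0"
  proof
    assume "norm z = 0"
    then have s: "scalar_part z = 0" and o: "onorm (left_action z) \<le> 0"
      by (simp_all add: norm_unitization_def max_def split: if_splits)
    from order.trans[OF norm_alg_part_le_onorm[OF s] o] s show "z = 0"
      by (simp add: unitization_eq_iff)
  next
    assume z: "z = 0"
    have "left_action (0 :: 'a unitization) = (\<lambda>x. 0)" by (simp add: left_action_def fun_eq_iff)
    then show "norm z = 0" by (simp add: norm_unitization_def z onorm_zero)
  qed
  show "norm (z + w) \<le> norm z + norm w"
    using onorm_triangle[OF bounded_linear_left_action bounded_linear_left_action, of z w]
      norm_triangle_ineq[of "scalar_part z" "scalar_part w"]
    unfolding norm_unitization_def left_action_add unitization_part_simps by linarith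
  show "norm (r *\<^sub>R z) = \<bar>r\<bar> * norm z"
    by (simp add: norm_unitization_def left_action_scaleR max_mult_distrib_left
        onorm_scaleR[OF bounded_linear_left_action])
  show "norm (z * w) \<le> norm z * norm w"
  proof -
    have "onorm (left_action (z * w)) \<le> onorm (left_action z) * onorm (left_action w)"
      unfolding left_action_mult
      by (intro onorm_compose bounded_linear_left_action)
    also have "\<dots> \<le> norm z * norm w"
      by (intro mult_mono)
        (auto simp: norm_unitization_def le_max_iff_disj onorm_pos_le[OF bounded_linear_left_action])
    finally have "onorm (left_action (z * w)) \<le> norm z * norm w" .
    moreover have "cmod (scalar_part (z * w)) \<le> norm z * norm w"
      unfolding unitization_part_simps norm_mult
      by (intro mult_mono) (auto simp: norm_unitization_def le_max_iff_disj)
    ultimately show ?thesis by (simp add: norm_unitization_def)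
  qed
  have "onorm (\<lambda>x::'a. x) \<le> 1" using onorm_id_le by (simp add: id_def)
  then show "norm (1::'a unitization) = 1"
    by (simp add: norm_unitization_def left_action_one max_absorb1)
qed

end

lemma norm_scalar_part_le: "norm (scalar_part z) \<le> norm z"
  by (simp add: norm_unitization_def)

lemma norm_unitization_le: "norm z \<le> norm (scalar_part z) + norm (alg_part z)"
proof -
  have "norm (left_action z x) \<le> (norm (scalar_part z) + norm (alg_part z)) * norm x" for x
    using norm_triangle_ineq[of "scalar_part z *\<^sub>C x" "alg_part z * x"]
      norm_mult_ineq[of "alg_part z" x]
    by (simp add: left_action_def norm_scaleC distrib_right)
  then have "onorm (left_action z) \<le> norm (scalar_part z) + norm (alg_part z)"
    by (intro onorm_bound) simp_all
  then show ?thesis by (simp add: norm_unitization_def)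
qed

lemma norm_Unitize_0 [simp]: "norm (Unitize 0 a) = norm a"
  using norm_unitization_le[of "Unitize 0 a"] norm_alg_part_le_onorm[of "Unitize 0 a"]
  by (simp add: norm_unitization_def max_absorb2 onorm_pos_le[OF bounded_linear_left_action])

text \<open>With the two preceding bounds on parts and sums, the norm is equivalent to the sum of
  the norms of the two parts, so completeness can be checked on each part.\<close>

lemma norm_alg_part_le: "norm (alg_part z) \<le> 2 * norm z"
proof -
  have "Unitize 0 (alg_part z) = z - Unitize (scalar_part z) 0"
    by (simp add: unitization_eq_iff)
  then have "norm (alg_part z) = norm (z - Unitize (scalar_part z) 0)"
    by (metis norm_Unitize_0)
  also have "\<dots> \<le> norm z + norm (Unitize (scalar_part z) (0::'a))"
    by (rule norm_triangle_ineq4)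
  also have "norm (Unitize (scalar_part z) (0::'a)) \<le> norm z"
    using norm_unitization_le[of "Unitize (scalar_part z) (0::'a)"] norm_scalar_part_le[of z]
    by simp
  finally show ?thesis by simp
qed

instance unitization :: (cstar_algebra) banach
proof
  fix X :: "nat \<Rightarrow> 'a unitization"
  assume X: "Cauchy X"
  have "bounded_linear (scalar_part :: 'a unitization \<Rightarrow> complex)"
    by (rule bounded_linear_intro[where K = 1]) (simp_all add: norm_scalar_part_le)
  from bounded_linear.Cauchy[OF this X] obtain l where l: "(\<lambda>n. scalar_part (X n)) \<longlonglongrightarrow> l"
    by (auto simp: convergent_def dest!: Cauchy_convergent)
  have "bounded_linear (alg_part :: 'a unitization \<Rightarrow> 'a)"
    by (rule bounded_linear_intro[where K = 2]) (simp_all add: norm_alg_part_le mult.commute[of _ 2])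
  from bounded_linear.Cauchy[OF this X] obtain a where a: "(\<lambda>n. alg_part (X n)) \<longlonglongrightarrow> a"
    by (auto simp: convergent_def dest!: Cauchy_convergent)
  have "(\<lambda>n. norm (scalar_part (X n) - l) + norm (alg_part (X n) - a)) \<longlonglongrightarrow> 0 + 0"
    using l a by (intro tendsto_add tendsto_norm_zero) (simp_all add: LIM_zero)
  then have lim: "(\<lambda>n. norm (scalar_part (X n) - l) + norm (alg_part (X n) - a)) \<longlonglongrightarrow> 0"
    by simp
  have "norm (X n - Unitize l a) \<le> norm (scalar_part (X n) - l) + norm (alg_part (X n) - a)" for n
    using norm_unitization_le[of "X n - Unitize l a"] by simp
  then have "(\<lambda>n. X n - Unitize l a) \<longlonglongrightarrow> 0"
    by (intro Lim_null_comparison[OF _ lim]) simp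
  then have "X \<longlonglongrightarrow> Unitize l a" by (rule LIM_zero_cancel)
  then show "convergent X" by (rule convergentI)
qed

instantiation unitization :: (cstar_algebra) unital_cstar_algebra
begin

definition "c *\<^sub>C z = Unitize (c * scalar_part z) (c *\<^sub>C alg_part z)"
definition "star z = Unitize (cnj (scalar_part z)) (star (alg_part z))"

instance
proof
  fix c d :: complex and r :: real and z w :: "'a unitization"
  show "r *\<^sub>R z = complex_of_real r *\<^sub>C z" "c *\<^sub>C (z + w) = c *\<^sub>C z + c *\<^sub>C w"
    "(c + d) *\<^sub>C z = c *\<^sub>C z + d *\<^sub>C z" "c *\<^sub>C d *\<^sub>C z = (c * d) *\<^sub>C z" "1 *\<^sub>C z = z"
    "(c *\<^sub>C z) * w = c *\<^sub>C (z * w)" "z * (c *\<^sub>C w) = c *\<^sub>C (z * w)"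
    "star (star z) = z" "star (z + w) = star z + star w" "star (c *\<^sub>C z) = cnj c *\<^sub>C star z"
    "star (z * w) = star w * star z"
    by (simp_all add: unitization_eq_iff scaleC_unitization_def star_unitization_def
        scaleR_scaleC scaleR_conv_of_real[where 'a = complex] scaleC_add_left scaleC_add_right scaleC_scaleC
        scaleC_one mult_scaleC_left mult_scaleC_right star_star star_add star_scaleC star_mult
        algebra_simps)
  have action_le: "norm (left_action (c *\<^sub>C z) x) = cmod c * norm (left_action z x)" for c z and x :: 'a
  proof -
    have "left_action (c *\<^sub>C z) x = c *\<^sub>C left_action z x"
      by (simp add: left_action_def scaleC_unitization_def scaleC_add_right scaleC_scaleC
          mult_scaleC_left)
    then show ?thesis by (simp add: norm_scaleC)
  qed
  have le: "norm (c *\<^sub>C z) \<le> cmod c * norm z" for c and z :: "'a unitization"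
  proof -
    have "onorm (left_action (c *\<^sub>C z)) \<le> cmod c * onorm (left_action z)"
      using onorm[OF bounded_linear_left_action, of z]
      by (intro onorm_bound)
        (auto simp: action_le mult.assoc onorm_pos_le[OF bounded_linear_left_action]
          intro!: mult_left_mono)
    then show ?thesis
      by (simp add: norm_unitization_def scaleC_unitization_def norm_mult max_mult_distrib_left
          max.coboundedI2)
  qed
  show "norm (c *\<^sub>C z) = cmod c * norm z"
  proof (cases "c = 0")
    case True
    then show ?thesis using le[of c z] by simp
  next
    case False
    then have "z = inverse c *\<^sub>C c *\<^sub>C z"
      by (simp add: unitization_eq_iff scaleC_unitization_def scaleC_scaleC scaleC_one)
    then have "norm z \<le> inverse (cmod c) * norm (c *\<^sub>C z)"
      using le[of "inverse c" "c *\<^sub>C z"] by (simp add: norm_inverse)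
    then show ?thesis using le[of c z] False by (simp add: field_simps)
  qed
  define N where "N = (\<lambda>z :: 'a unitization. onorm (left_action z))"
  have N_pos: "0 \<le> N z" for z by (simp add: N_def onorm_pos_le[OF bounded_linear_left_action])
  have N_mult: "N (z * w) \<le> N z * N w" for z w
    unfolding N_def left_action_mult by (intro onorm_compose bounded_linear_left_action)
  \<comment> \<open>The C*-identity of the original algebra, applied to
    \<open>left_action z b\<close>, turns its squared norm into the norm of
    \<open>star b * left_action (star z * z) b\<close>.\<close>
  have N_square: "(N z)\<^sup>2 \<le> N (star z * z)" for z
  proof -
    have "N z \<le> sqrt (N (star z * z))"
      unfolding N_def
    proof (rule onorm_bound)
      fix b :: 'a
      have "star (left_action z b) * left_action z b = star b * left_action (star z * z) b"
        by (simp add: left_action_mult) (simp add: left_action_def star_unitization_def star_add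
            star_scaleC star_mult algebra_simps mult_scaleC_left mult_scaleC_right
            scaleC_add_right scaleC_scaleC)
      then have "(norm (left_action z b))\<^sup>2 = norm (star b * left_action (star z * z) b)"
        by (metis cstar_identity)
      also have "\<dots> \<le> norm b * norm (left_action (star z * z) b)"
        using norm_mult_ineq[of "star b"] by simp
      also have "\<dots> \<le> norm b * (N (star z * z) * norm b)"
        unfolding N_def by (intro mult_left_mono onorm bounded_linear_left_action norm_ge_zero)
      also have "\<dots> = (sqrt (N (star z * z)) * norm b)\<^sup>2"
        by (simp add: power_mult_distrib N_pos power2_eq_square)
      finally show "norm (left_action z b) \<le> sqrt (onorm (left_action (star z * z))) * norm b"
        unfolding N_def by (rule power2_le_imp_le) (simp add: onorm_pos_le[OF bounded_linear_left_action])
    qed (simp add: onorm_pos_le[OF bounded_linear_left_action])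
    then show ?thesis using N_pos by (metis real_sqrt_le_iff real_sqrt_abs abs_of_nonneg)
  qed
  have N_le_star: "N z \<le> N (star z)" for z
  proof (cases "N z = 0")
    case False
    have "N z * N z \<le> N (star z) * N z"
      using N_square[of z] N_mult[of "star z" z] by (simp only: power2_eq_square)
    with False N_pos[of z] show ?thesis by simp
  qed (simp add: N_pos)
  have "N (star z) = N z"
    using N_le_star[of z] N_le_star[of "star z"] \<open>star (star z) = z\<close> by simp
  then have "N (star z * z) = (N z)\<^sup>2"
    using N_square[of z] N_mult[of "star z" z] by (simp add: power2_eq_square)
  moreover have "cmod (scalar_part (star z * z)) = (cmod (scalar_part z))\<^sup>2"
    by (simp add: star_unitization_def norm_mult power2_eq_square)
  moreover have "max (a\<^sup>2) (b\<^sup>2) = (max a b)\<^sup>2" if "0 \<le> a" "0 \<le> b" for a b :: real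
    using that by (auto simp: max_def dest: power2_le_imp_le power_mono[of _ _ 2])
  ultimately show "norm (star z * z) = (norm z)\<^sup>2"
    using N_pos[of z] by (simp add: norm_unitization_def N_def)
qed

end

lemma Unitize_0_simps:
  "Unitize 0 a + Unitize 0 b = Unitize 0 (a + b)"
  "Unitize 0 a - Unitize 0 b = Unitize 0 (a - b)"
  "Unitize 0 a * Unitize 0 b = Unitize 0 (a * b)"
  "r *\<^sub>R Unitize 0 a = Unitize 0 (r *\<^sub>R a)"
  "c *\<^sub>C Unitize 0 a = Unitize 0 (c *\<^sub>C a)"
  "star (Unitize 0 a) = Unitize 0 (star a)"
  by (simp_all add: unitization_eq_iff scaleC_unitization_def star_unitization_def)

subsection \<open>Partial isometries\<close>

lemma norm_eq_0_if_star_mult: "star x * x = 0 \<Longrightarrow> x = (0::'a::cstar_algebra)"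
  using cstar_identity[of x] by simp

text \<open>For \<open>p = star x * x\<close> and \<open>d = x * p - x\<close>, the product
  \<open>star d * d\<close> is a polynomial in \<open>p\<close> that vanishes if
  \<open>p * p = p\<close>; the C*-identity then gives \<open>d = 0\<close>.\<close>

lemma partial_isometry_iff:
  fixes x :: "'a::cstar_algebra"
  shows "partial_isometry x \<longleftrightarrow> x * (star x * x) = x"
proof
  assume "partial_isometry x"
  then have p: "star x * x * (star x * x) = star x * x"
    by (simp add: partial_isometry_def projection_def)
  have "star (x * (star x * x) - x) * (x * (star x * x) - x) =
      (star x * x * (star x * x)) * (star x * x) - star x * x * (star x * x)
      - (star x * x * (star x * x) - star x * x)"
    by (simp add: star_diff star_mult star_star algebra_simps)
  also have "\<dots> = 0" by (simp add: p)
  finally show "x * (star x * x) = x" using norm_eq_0_if_star_mult by fastforce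
next
  assume x: "x * (star x * x) = x"
  have "star x * x * (star x * x) = star x * x" using x by (metis mult.assoc)
  then show "partial_isometry x"
    by (simp add: partial_isometry_def projection_def star_mult star_star)
qed

lemma partial_isometry_star:
  assumes "partial_isometry x"
  shows "partial_isometry (star x)"
proof -
  have "star (x * (star x * x)) = star x" using assms by (simp add: partial_isometry_iff)
  then show ?thesis by (simp add: partial_isometry_iff star_mult star_star mult.assoc)
qed

text \<open>Without mixed terms \<open>(a + b) ^ n = a ^ n + b ^ n\<close>, so the powers are
  bounded up to a factor \<open>2\<close>, which disappears on taking roots. The lower bound comes
  from \<open>(a + b) * a = a * a\<close>.\<close>

lemma norm_add_orthogonal:
  fixes a b :: "'a::unital_cstar_algebra"
  assumes sa: "star a = a" "star b = b" and ab: "a * b = 0"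
  shows "norm (a + b) = max (norm a) (norm b)"
proof (rule antisym)
  have ba: "b * a = 0" using arg_cong[OF ab, of star] by (simp add: star_mult sa)
  have pow: "(a + b) ^ Suc n = a ^ Suc n + b ^ Suc n" for n
  proof (induction n)
    case (Suc n)
    have "a * b ^ Suc n = 0" "b * a ^ Suc n = 0"
      by (simp_all add: ab ba flip: mult.assoc)
    then show ?case unfolding power_Suc[of "a + b" "Suc n"] Suc by (simp add: algebra_simps)
  qed simp
  let ?M = "max (norm a) (norm b)"
  have "norm (a + b) ^ 2 ^ n \<le> (2 + 0 * 2 ^ n) * ?M ^ 2 ^ n" for n
  proof -
    have "norm (a + b) ^ 2 ^ n = norm ((a + b) ^ 2 ^ n)"
      by (simp add: norm_power_two_power star_add sa)
    also have "(a + b) ^ 2 ^ n = a ^ 2 ^ n + b ^ 2 ^ n"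
      using pow[of "2 ^ n - 1"] by simp
    also have "norm \<dots> \<le> norm a ^ 2 ^ n + norm b ^ 2 ^ n"
      using norm_triangle_ineq[of "a ^ 2 ^ n" "b ^ 2 ^ n"] by (simp add: norm_power_two_power sa)
    also have "\<dots> \<le> ?M ^ 2 ^ n + ?M ^ 2 ^ n"
      by (intro add_mono power_mono) auto
    finally show ?thesis by simp
  qed
  then show "norm (a + b) \<le> ?M" using power_growth_le[of ?M "norm (a + b)" 2 0]
    by (simp add: le_max_iff_disj)
  have le: "norm c \<le> norm (c + d)"
    if "star c = c" "d * c = 0" for c d :: 'a
  proof (cases "c = 0")
    case False
    have "norm c * norm c = norm ((c + d) * c)"
      using cstar_identity[of c] that by (simp add: power2_eq_square algebra_simps)
    also have "\<dots> \<le> norm (c + d) * norm c" by (rule norm_mult_ineq)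
    finally show ?thesis using False by simp
  qed simp
  show "?M \<le> norm (a + b)"
    using le[of a b] le[of b a] sa ab ba by (simp add: add.commute)
qed

lemma mult_star_eq_0_if_norm_le:
  fixes x z :: "'a::unital_cstar_algebra"
  assumes x: "partial_isometry x" "norm x \<le> 1"
    and "norm (x + z) \<le> 1" "norm (x - z) \<le> 1"
  shows "z * star x = 0"
proof -
  define p where "p = star x * x"
  have p: "star p = p" "p * p = p"
    using x by (simp_all add: p_def partial_isometry_def projection_def)
  have pos: "cstar_positive (1 - star w * w)" if "norm w \<le> 1" for w :: 'a
    using positive_of_real_diff[of "star w * w" 1] that
    by (simp add: cstar_identity star_mult star_star power_le_one)
  have "cstar_positive ((1 - star (x + z) * (x + z)) + (1 - star (x - z) * (x - z)))"
    using assms by (intro positive_add pos)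
  also have "(1 - star (x + z) * (x + z)) + (1 - star (x - z) * (x - z)) =
      2 *\<^sub>R (1 - p - star z * z)"
    by (simp add: p_def star_add star_diff algebra_simps scaleR_2)
  finally have pos_a: "cstar_positive (1 - p - star z * z)"
    by (subst (asm) positive_scaleR_iff) simp_all
  \<comment> \<open>Compression by \<open>p\<close> kills \<open>1 - p\<close>. As roots exist only
    after a shift by \<open>e\<close>, this yields \<open>e *\<^sub>R p - v\<close> as a product
    \<open>star (s * p) * (s * p)\<close>, hence \<open>norm v \<le> e\<close> for every
    \<open>e > 0\<close>.\<close>
  define v where "v = star (z * p) * (z * p)"
  have "norm v \<le> 0 + e" if e: "0 < e" for e :: real
  proof -
    obtain s where s: "star s = s" "s * s = 1 - p - star z * z + of_real e"
      using positive_sqrt[OF pos_a e] by blast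
    have "star (s * p) * (s * p) = p * (s * s) * p"
      by (simp add: star_mult s(1) p(1) mult.assoc)
    also have "\<dots> = e *\<^sub>R p - v"
      unfolding s(2) v_def
      by (simp add: star_mult p algebra_simps of_real_def)
    finally have "cstar_positive (e *\<^sub>R p - v)" using positive_star_mult_self by metis
    then have "norm v \<le> norm (e *\<^sub>R p)"
      unfolding v_def using positive_norm_mono positive_star_mult_self by blast
    also have "\<dots> \<le> e"
      using e x(2) by (simp add: p_def cstar_identity power_le_one)
    finally show ?thesis by simp
  qed
  then have "norm v \<le> 0" by (rule field_le_epsilon)
  then have "z * p = 0" unfolding v_def using norm_eq_0_if_star_mult by fastforce
  moreover have "p * star x = star x"
    using partial_isometry_star[OF x(1)] by (simp add: partial_isometry_iff p_def star_star mult.assoc)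
  ultimately show ?thesis by (metis mult.assoc mult_zero_left)
qed

lemma norm_add_scaleC_partial_isometry:
  fixes x z :: "'a::unital_cstar_algebra"
  assumes x: "partial_isometry x" "norm x = 1"
    and z: "norm (x + z) \<le> 1" "norm (x - z) \<le> 1"
  shows "norm (x + c *\<^sub>C z) = max 1 (norm (c *\<^sub>C z))"
proof -
  define w where "w = c *\<^sub>C z"
  have "z * star x = 0" using mult_star_eq_0_if_norm_le[of x z] x z by simp
  then have wx: "w * star x = 0" by (simp add: w_def mult_scaleC_left)
  \<comment> \<open>The adjoints satisfy the same hypotheses, which gives the orthogonality on the
    other side.\<close>
  have "norm (star x + star z) \<le> 1" "norm (star x - star z) \<le> 1"
    using z by (simp_all flip: star_add star_diff)
  then have zx: "star z * x = 0"
    using mult_star_eq_0_if_norm_le[of "star x" "star z"] partial_isometry_star[OF x(1)]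
      star_star[of x] x(2) by simp
  have "star x * z = 0"
    using arg_cong[OF zx, of star] by (simp add: star_mult star_star)
  then have xw: "star x * w = 0" by (simp add: w_def mult_scaleC_right)
  have wx': "star w * x = 0"
    using arg_cong[OF xw, of star] by (simp add: star_mult star_star)
  have "(norm (x + w))\<^sup>2 = norm (star x * x + star w * w)"
    by (simp add: star_add algebra_simps xw wx' flip: cstar_identity)
  also have "\<dots> = max (norm (star w * w)) (norm (star x * x))"
  proof -
    have "star w * w * (star x * x) = star w * (w * star x) * x" by (simp only: mult.assoc)
    then show ?thesis
      using norm_add_orthogonal[of "star w * w" "star x * x"]
      by (simp add: wx star_mult star_star add.commute)
  qed
  also have "\<dots> = max ((norm w)\<^sup>2) 1" by (simp add: cstar_identity x)
  also have "\<dots> = (max 1 (norm w))\<^sup>2"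
    by (auto simp: max_def power_le_one_iff one_le_power abs_square_le_1 power2_eq_1_iff
        dest: power_mono[of _ _ 2])
  finally show ?thesis unfolding w_def by (simp add: power2_eq_iff_nonneg le_max_iff_disj)
qed

text \<open>With \<open>h = 1 - 2 k\<close>, the perturbed element is
  \<open>w = x * (1 + k)\<close>, and \<open>1 - star w * w\<close> is the polynomial
  \<open>k * k * (2 k + 3)\<close>. A root \<open>s\<close> of \<open>2 k + 3\<close> exhibits it as
  the square of \<open>s * k\<close>.\<close>

lemma norm_add_half_defect_le:
  fixes x :: "'a::unital_cstar_algebra"
  assumes "norm x \<le> 1"
  shows "norm (x + (1/2) *\<^sub>R (x - x * (star x * x))) \<le> 1"
proof -
  define h where "h = star x * x"
  define k where "k = (1/2) *\<^sub>R (1 - h)"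
  define w where "w = x + (1/2) *\<^sub>R (x - x * (star x * x))"
  have sa: "star h = h" by (simp add: h_def star_mult star_star)
  have "k + k = 1 - h" by (simp add: k_def flip: scaleR_add_left)
  then have h: "h = 1 - k - k" by (simp add: algebra_simps)
  have sa_k: "star k = k" by (simp add: k_def star_diff sa)
  have pos: "cstar_positive (k + k)"
    using positive_of_real_diff[of h 1] assms sa h
    by (simp add: h_def cstar_identity power_le_one)
  have "(0::real) < 3" by simp
  from positive_sqrt[OF pos this] obtain s where s: "star s = s" "s * s = k + k + of_real 3"
    and comm: "\<And>l. l * (k + k) = (k + k) * l \<Longrightarrow> l * s = s * l"
    by blast
  have ks: "k * s = s * k" by (rule comm) (simp add: algebra_simps)
  have "star (s * k) = s * k" by (simp add: star_mult s(1) sa_k ks)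
  then have "cstar_positive ((s * k) * (s * k))" by (rule positive_square)
  also have "(s * k) * (s * k) = k * (s * s) * k" by (metis mult.assoc ks)
  also have "\<dots> = 1 - (1 + k) * h * (1 + k)"
  proof -
    have "(of_real 3 :: 'a) = 1 + 1 + 1" by simp
    then show ?thesis unfolding s(2) h by (simp add: algebra_simps del: one_add_one of_real_numeral)
  qed
  also have "(1 + k) * h * (1 + k) = star w * w"
  proof -
    have "w = x * (1 + k)" by (simp add: w_def k_def h_def algebra_simps)
    then show ?thesis by (simp add: h_def star_mult star_add sa_k mult.assoc)
  qed
  finally have "norm (star w * w) \<le> norm (1::'a)"
    using positive_star_mult_self positive_norm_mono by blast
  then have "norm w \<le> 1" by (simp add: cstar_identity power_le_one_iff abs_square_le_1)
  then show ?thesis by (simp add: w_def)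
qed

text \<open>No maximum point is needed: \<open>u - (2 b + b ^ 2) v = h + 2 b h (1 - h) h\<close> is
  positive. Since \<open>norm v = 1 / b ^ 2\<close>, comparing norms would give
  \<open>1 + 2 / b \<le> norm u \<le> 1\<close>.\<close>

lemma norm_add_normalized_defect_gt_1:
  fixes x :: "'a::unital_cstar_algebra"
  assumes "norm x \<le> 1" and y: "y = x - x * (star x * x)"
    and "b > 0" and by1: "norm (b *\<^sub>R y) = 1"
  shows "norm (x + b *\<^sub>R y) > 1"
proof (rule ccontr)
  assume "\<not> norm (x + b *\<^sub>R y) > 1"
  then have le: "norm (x + b *\<^sub>R y) \<le> 1" by simp
  define h where "h = star x * x"
  define e where "e = 1 - h"
  \<comment> \<open>The root of \<open>e\<close> needs a positive shift \<open>d\<close>. This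
    choice makes the resulting error \<open>2 * b * d\<close> equal to \<open>1 / b\<close>, half of
    the gap \<open>2 / b\<close>.\<close>
  define d where "d = 1 / (2 * b\<^sup>2)"
  define u where "u = star (x + b *\<^sub>R y) * (x + b *\<^sub>R y)"
  define v where "v = star y * y"
  have sa: "star h = h" by (simp add: h_def star_mult star_star)
  have d: "d > 0" using assms by (simp add: d_def)
  have norm_h: "norm h \<le> 1" using assms(1) by (simp add: h_def cstar_identity power_le_one)
  then have "cstar_positive e" using positive_of_real_diff[of h 1] sa by (simp add: e_def)
  then obtain s where s: "star s = s" "s * s = e + of_real d"
    using positive_sqrt[OF _ d] by blast
  have "star (s * h) * (s * h) = h * (s * s) * h" by (simp add: star_mult s(1) sa mult.assoc)
  then have "cstar_positive (h * (s * s) * h)" by (metis positive_star_mult_self)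
  then have "cstar_positive (h + (2 * b) *\<^sub>R (h * (s * s) * h))"
    using assms positive_star_mult_self unfolding h_def
    by (intro positive_add positive_scaleR) auto
  also have "h + (2 * b) *\<^sub>R (h * (s * s) * h) =
      (u + (2 * b) *\<^sub>R d *\<^sub>R (h * h)) - ((2 * b) *\<^sub>R v + b\<^sup>2 *\<^sub>R v)"
  proof -
    have v: "v = h - h * h - (h * h - h * h * h)"
      by (simp add: v_def y h_def star_diff star_mult star_star algebra_simps)
    have hsh: "h * (s * s) * h = h * h - h * h * h + d *\<^sub>R (h * h)"
      unfolding s(2) e_def by (simp add: algebra_simps of_real_def)
    have "u = h + b *\<^sub>R (star x * y + star y * x) + b\<^sup>2 *\<^sub>R v"
      by (simp add: u_def v_def h_def star_add algebra_simps power2_eq_square)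
    also have "star x * y + star y * x = (h - h * h) + (h - h * h)"
      by (simp add: y h_def star_diff star_mult star_star algebra_simps)
    finally have u: "u = h + b *\<^sub>R ((h - h * h) + (h - h * h)) + b\<^sup>2 *\<^sub>R v" .
    have twice: "(2 * b) *\<^sub>R a = b *\<^sub>R a + b *\<^sub>R a" for a :: 'a
      unfolding mult_2 by (rule scaleR_add_left)
    show ?thesis unfolding hsh u twice v by (simp add: algebra_simps)
  qed
  also have "(2 * b) *\<^sub>R v + b\<^sup>2 *\<^sub>R v = (2 * b + b\<^sup>2) *\<^sub>R v" by (simp add: scaleR_add_left)
  also have "(2 * b) *\<^sub>R d *\<^sub>R (h * h) = (2 * b * d) *\<^sub>R (h * h)" by simp
  finally have "norm ((2 * b + b\<^sup>2) *\<^sub>R v) \<le> norm (u + (2 * b * d) *\<^sub>R (h * h))"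
    using assms positive_star_mult_self unfolding v_def
    by (intro positive_norm_mono positive_scaleR) auto
  also have "\<dots> \<le> norm u + (2 * b * d) * norm (h * h)"
    using norm_triangle_ineq[of u "(2 * b * d) *\<^sub>R (h * h)"] assms d by simp
  also have "\<dots> \<le> 1 + (2 * b * d) * 1"
  proof (intro add_mono mult_left_mono)
    show "norm u \<le> 1" using le by (simp add: u_def cstar_identity power_le_one)
    show "norm (h * h) \<le> 1"
      using norm_h norm_mult_ineq[of h h] mult_mono[OF norm_h norm_h] by simp
  qed (use assms d in auto)
  also have "\<dots> = 1 + 1 / b" using assms by (simp add: d_def power2_eq_square)
  also have "norm ((2 * b + b\<^sup>2) *\<^sub>R v) = 1 + 2 / b"
  proof -
    have "norm y = 1 / b" using by1 assms by (simp add: field_simps)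
    moreover have "norm ((2 * b + b\<^sup>2) *\<^sub>R v) = (2 * b + b\<^sup>2) * (norm y)\<^sup>2"
      using \<open>b > 0\<close> by (simp add: v_def cstar_identity)
    ultimately have "norm ((2 * b + b\<^sup>2) *\<^sub>R v) = (2 * b + b\<^sup>2) * (1 / b)\<^sup>2" by (simp only:)
    also have "\<dots> = 1 + 2 / b" using \<open>b > 0\<close> by (simp add: power2_eq_square field_simps)
    finally show ?thesis .
  qed
  finally show False using assms by (simp add: field_simps)
qed

theorem theorem1:
  fixes x :: "'a::cstar_algebra"
  assumes "norm x = 1"
  shows "partial_isometry x \<longleftrightarrow>
    {y. \<exists>a::real. a > 0 \<and> norm (x + a *\<^sub>R y) = 1 \<and> norm (x - a *\<^sub>R y) = 1} =
    {y. \<forall>b::complex. norm (x + b *\<^sub>C y) = max 1 (norm (b *\<^sub>C y))}"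
    (is "_ \<longleftrightarrow> ?D1 = ?D2")
proof
  define \<iota> :: "'a \<Rightarrow> 'a unitization" where "\<iota> = Unitize 0"
  have embed: "\<iota> u + \<iota> v = \<iota> (u + v)" "\<iota> u - \<iota> v = \<iota> (u - v)" "\<iota> u * \<iota> v = \<iota> (u * v)"
    "r *\<^sub>R \<iota> u = \<iota> (r *\<^sub>R u)" "c *\<^sub>C \<iota> u = \<iota> (c *\<^sub>C u)" "star (\<iota> u) = \<iota> (star u)"
    "norm (\<iota> u) = norm u" for u v r c
    by (simp_all add: \<iota>_def Unitize_0_simps)
  {
    assume x: "partial_isometry x"
    then have "partial_isometry (\<iota> x)" by (simp add: partial_isometry_iff embed)
    show "?D1 = ?D2"
    proof (intro equalityI subsetI CollectI allI)
      fix y b assume "y \<in> ?D1"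
      then obtain a :: real where a: "a > 0" "norm (x + a *\<^sub>R y) = 1" "norm (x - a *\<^sub>R y) = 1"
        by blast
      have "norm (x + c *\<^sub>C a *\<^sub>R y) = max 1 (norm (c *\<^sub>C a *\<^sub>R y))" for c
        using norm_add_scaleC_partial_isometry[of "\<iota> x" "\<iota> (a *\<^sub>R y)" c]
          \<open>partial_isometry (\<iota> x)\<close> assms a by (simp add: embed)
      \<comment> \<open>The orthogonality was obtained for \<open>a *\<^sub>R y\<close>; dividing
        the coefficient by \<open>a\<close> returns to \<open>y\<close>.\<close>
      from this[of "b / complex_of_real a"]
      show "norm (x + b *\<^sub>C y) = max 1 (norm (b *\<^sub>C y))"
        using a by (simp add: scaleR_scaleC scaleC_scaleC)
    next
      fix y assume "y \<in> ?D2"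
      then have y: "norm (x + b *\<^sub>C y) = max 1 (norm (b *\<^sub>C y))" for b by blast
      \<comment> \<open>This makes \<open>norm (a *\<^sub>R y)\<close> at most \<open>1\<close>, so
        the maximum is \<open>1\<close> for both coefficients \<open>a\<close> and
        \<open>- a\<close>.\<close>
      define a where "a = 1 / (1 + norm y)"
      have a: "a > 0" "a * norm y \<le> 1"
        by (simp_all add: a_def add_pos_nonneg divide_le_eq)
      then show "\<exists>a>0. norm (x + a *\<^sub>R y) = 1 \<and> norm (x - a *\<^sub>R y) = 1"
        using y[of "complex_of_real a"] y[of "- complex_of_real a"]
        by (intro exI[of _ a]) (simp add: scaleR_scaleC scaleC_minus_left norm_scaleC)
    qed
  next
    assume D: "?D1 = ?D2"
    define y where "y = x - x * (star x * x)"
    have plus: "norm (x + (1/2) *\<^sub>R y) \<le> 1"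
      using norm_add_half_defect_le[of "\<iota> x"] assms by (simp add: embed y_def)
    \<comment> \<open>The element is the midpoint of \<open>x\<close> and
      \<open>x * (star x * x)\<close>, both in the unit ball.\<close>
    have minus: "norm (x - (1/2) *\<^sub>R y) \<le> 1"
    proof -
      have "norm (x * (star x * x)) \<le> 1"
        using norm_mult_ineq[of x "star x * x"] by (simp add: cstar_identity assms)
      moreover have "x - (1/2) *\<^sub>R y = (1/2) *\<^sub>R x + (1/2) *\<^sub>R (x * (star x * x))"
        by (simp add: y_def algebra_simps flip: scaleR_add_left)
      ultimately show ?thesis
        using norm_triangle_ineq[of "(1/2) *\<^sub>R x" "(1/2) *\<^sub>R (x * (star x * x))"] assms by simp
    qed
    \<comment> \<open>Membership in \<open>?D1\<close> asks for norms equal to \<open>1\<close>: the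
      two elements sum to \<open>2 *\<^sub>R x\<close>, of norm \<open>2\<close>, so neither norm
      can be smaller.\<close>
    have "2 *\<^sub>R x = (x + (1/2) *\<^sub>R y) + (x - (1/2) *\<^sub>R y)" by (simp add: scaleR_2)
    then have "2 \<le> norm (x + (1/2) *\<^sub>R y) + norm (x - (1/2) *\<^sub>R y)"
      using norm_triangle_ineq[of "x + (1/2) *\<^sub>R y" "x - (1/2) *\<^sub>R y"] assms
      by (metis abs_numeral mult.right_neutral norm_scaleR)
    with plus minus have "norm (x + (1/2) *\<^sub>R y) = 1" "norm (x - (1/2) *\<^sub>R y) = 1" by linarith+
    then have "y \<in> ?D1" by (intro CollectI exI[of _ "1/2"]) simp
    then have y: "norm (x + b *\<^sub>C y) = max 1 (norm (b *\<^sub>C y))" for b using D by blast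
    have "y = 0"
    proof (rule ccontr)
      assume "y \<noteq> 0"
      define b where "b = 1 / norm y"
      have b: "b > 0" "norm (b *\<^sub>R y) = 1" using \<open>y \<noteq> 0\<close> by (simp_all add: b_def)
      then have "norm (x + b *\<^sub>R y) = 1"
        using y[of "complex_of_real b"] by (simp flip: scaleR_scaleC)
      then show False
        using norm_add_normalized_defect_gt_1[of "\<iota> x" "\<iota> y" b] b assms by (simp add: embed y_def)
    qed
    then show "partial_isometry x" by (simp add: partial_isometry_iff y_def)
  }
qed

end
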